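(* Let $\varepsilon\in(0,\tfrac12)$ and let $A\subseteq[1-\varepsilon,1]$. Define $d_1:A\times A\to[0,\infty)$ by $d_1(x,y)=0$ if $x=y$ and $d_1(x,y)=\max\{1-x,1-y\}$ if $x\ne y$. Then $d_1$ is an ultrametric on $A$.
   Context: An ultrametric is a metric $d$ satisfying $d(x,z)\le\max\{d(x,y),d(y,z)\}$ for all $x,y,z$. *)

theory Defs
  imports "HOL-Analysis.Analysis"
begin

definition ultrametric_on :: "'a set \<Rightarrow> ('a \<Rightarrow> 'a \<Rightarrow> real) \<Rightarrow> bool" where
  "ultrametric_on M d \<longleftrightarrow>
     Metric_space M d \<and> (\<forall>x\<in>M. \<forall>y\<in>M. \<forall>z\<in>M. d x z \<le> max (d x y) (d y z))"

(* The locale Metric_space requires nonnegativity and symmetry on the whole type and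
   not only on the carrier. So the function d1, defined on A x A, is extended by 0 to
   pairs of reals outside A x A, where the formula max (1 - x) (1 - y) could be negative. *)
definition d1 :: "real set \<Rightarrow> real \<Rightarrow> real \<Rightarrow> real" where
  "d1 A x y =
     (if x \<in> A \<and> y \<in> A then (if x = y then 0 else max (1 - x) (1 - y)) else 0)"

end

theory Submission
  imports Defs
begin

text \<open>
  Write \<open>h x = 1 - x\<close>, a nonnegative function on \<open>A\<close> that vanishes at most at the point \<open>1\<close>.
  Two distinct points lie at distance \<open>max (h x) (h y)\<close>. This maximum is positive because \<open>h\<close> cannot
  vanish at two distinct points, so distance \<open>0\<close> forces equality. In the strong triangle
  inequality with three distinct points, \<open>h x\<close> is already bounded by the distance from \<open>x\<close> to \<open>y\<close>
  and \<open>h z\<close> by the distance from \<open>y\<close> to \<open>z\<close>. The ordinary triangle inequality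
  follows, since a maximum of nonnegative numbers is at most their sum.
\<close>

lemma ultrametric_onI:
  assumes nonneg: "\<And>x y. 0 \<le> d x y"
    and commute: "\<And>x y. d x y = d y x"
    and zero: "\<And>x y. x \<in> M \<Longrightarrow> y \<in> M \<Longrightarrow> d x y = 0 \<longleftrightarrow> x = y"
    and strong_triangle:
      "\<And>x y z. x \<in> M \<Longrightarrow> y \<in> M \<Longrightarrow> z \<in> M \<Longrightarrow> d x z \<le> max (d x y) (d y z)"
  shows "ultrametric_on M d"
proof -
  have "d x z \<le> d x y + d y z" if "x \<in> M" "y \<in> M" "z \<in> M" for x y z
    using strong_triangle[OF that] nonneg[of x y] nonneg[of y z] by linarith
  then have "Metric_space M d"
    using nonneg commute zero by unfold_locales auto
  then show ?thesis
    using strong_triangle by (simp add: ultrametric_on_def)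
qed

lemma d1_nonneg:
  assumes "A \<subseteq> {..1}"
  shows "0 \<le> d1 A x y"
  using assms by (auto simp: d1_def le_max_iff_disj)

lemma d1_commute: "d1 A x y = d1 A y x"
  by (simp add: d1_def max.commute)

text \<open>Of two distinct points of \<open>A\<close>, the smaller one is strictly below \<open>1\<close>.\<close>

lemma d1_eq_0_iff:
  assumes "A \<subseteq> {..1}" "x \<in> A" "y \<in> A"
  shows "d1 A x y = 0 \<longleftrightarrow> x = y"
proof -
  have "x \<le> 1" "y \<le> 1"
    using assms by auto
  then show ?thesis
    using assms(2,3) by (auto simp: d1_def max_def)
qed

text \<open>
  If \<open>y\<close> coincides with \<open>x\<close> or \<open>z\<close>, the left-hand side is one of the two distances on the right;
  if \<open>x = z\<close>, it is \<open>0\<close>, and the bound \<open>A \<subseteq> {..1}\<close> makes the right-hand side nonnegative.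
  For three distinct points, each term of the maximum on the left occurs on the right.
\<close>

lemma d1_strong_triangle:
  assumes "A \<subseteq> {..1}" "x \<in> A" "y \<in> A" "z \<in> A"
  shows "d1 A x z \<le> max (d1 A x y) (d1 A y z)"
proof -
  have "x \<le> 1" "y \<le> 1" "z \<le> 1"
    using assms by auto
  then show ?thesis
    using assms(2-4) by (auto simp: d1_def max_def)
qed

theorem proposition5p1:
  fixes \<epsilon> :: real and A :: "real set"
  assumes "\<epsilon> \<in> {0<..<1/2}"
    and "A \<subseteq> {1 - \<epsilon>..1}"
  shows "ultrametric_on A (d1 A)"
proof -
  have A: "A \<subseteq> {..1}"
    using assms(2) by auto
  show ?thesis
    by (intro ultrametric_onI d1_nonneg d1_commute d1_eq_0_iff d1_strong_triangle A)
qed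

end
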